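(* Let $\Omega\subset\mathbb{R}^N$ be an open set, $N\geq 1$, $p>1$, $A\in C^1(\Omega)$ and $X\in C^1(\Omega,\mathbb{R}^N)$. Then for any $u\in C_0^1(\Omega)$, $$\int_{\Omega}A|\nabla u|^{p}\,dx-\int_{\Omega}\left(-\operatorname{div}\left(A|X|^{p-2}X\right)-(p-1)A|X|^{p}\right)|u|^{p}\,dx=\int_{\Omega}A\,\mathcal{R}_{p}\left(uX,\nabla u\right)dx$$ and $$\int_{\Omega}A\left|\frac{X}{|X|}\cdot\nabla u\right|^{p}dx-\int_{\Omega}\left(-\operatorname{div}\left(A|X|^{p-2}X\right)-(p-1)A|X|^{p}\right)|u|^{p}\,dx=\int_{\Omega}A\,\mathcal{R}_{p}\left(u|X|,\ \frac{X}{|X|}\cdot\nabla u\right)dx.$$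
   Context: Functions are real valued and $C_0^1(\Omega)$ denotes $C^1$ functions with compact support in $\Omega$. For $n\ge 1$ and $a,b\in\mathbb{R}^n$, $$\mathcal{R}_p(a,b)=|b|^p+(p-1)|a|^p-p|a|^{p-2}a\cdot b,$$ with $|a|^{p-2}a:=0$ when $a=0$ (in the first identity $n=N$; in the second identity the arguments are scalars, $n=1$). Conventions: $|X|^{p-2}X:=0$ and $\frac{X}{|X|}:=0$ at points where $X=0$. If $A|X|^{p-2}X$ is not $C^1$ (possible when $1<p<2$ and $X$ has zeros), its divergence is understood in the distributional sense, i.e. $-\int_\Omega \operatorname{div}(A|X|^{p-2}X)|u|^p\,dx$ means $\int_\Omega A|X|^{p-2}X\cdot\nabla(|u|^p)\,dx$. *)

theory Defs
  imports "HOL-Analysis.Analysis"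
begin

definition C1_on :: "'a::euclidean_space set \<Rightarrow> ('a \<Rightarrow> 'b::real_normed_vector) \<Rightarrow> bool" where
  "C1_on \<Omega> f \<longleftrightarrow>
     (\<exists>f' :: 'a \<Rightarrow> 'a \<Rightarrow>\<^sub>L 'b.
        (\<forall>x\<in>\<Omega>. (f has_derivative blinfun_apply (f' x)) (at x)) \<and> continuous_on \<Omega> f')"

text \<open>Functions on \<open>\<Omega>\<close> are represented by total functions whose values outside \<open>\<Omega>\<close> are irrelevant,
  hence the support is formed from the points of \<open>\<Omega>\<close> only.\<close>

definition C1_compact_support :: "'a::euclidean_space set \<Rightarrow> ('a \<Rightarrow> real) \<Rightarrow> bool" where
  "C1_compact_support \<Omega> u \<longleftrightarrow>
     C1_on \<Omega> u \<and> compact (closure {x\<in>\<Omega>. u x \<noteq> 0}) \<and> closure {x\<in>\<Omega>. u x \<noteq> 0} \<subseteq> \<Omega>"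

definition grad :: "('a::euclidean_space \<Rightarrow> real) \<Rightarrow> 'a \<Rightarrow> 'a" where
  "grad f x = (\<Sum>b\<in>Basis. frechet_derivative f (at x) b *\<^sub>R b)"

definition divergence :: "('a::euclidean_space \<Rightarrow> 'a) \<Rightarrow> 'a \<Rightarrow> real" where
  "divergence F x = (\<Sum>b\<in>Basis. frechet_derivative F (at x) b \<bullet> b)"

text \<open>The vector \<open>|v|^(p-2) v\<close>. At \<open>v = 0\<close> it is \<open>0\<close>, as required.\<close>

definition pow_vec :: "real \<Rightarrow> 'a::real_inner \<Rightarrow> 'a" where
  "pow_vec p v = norm v powr (p - 2) *\<^sub>R v"

text \<open>For scalar arguments take \<open>'a = real\<close>, where \<open>norm\<close> is the absolute value and the inner
  product is multiplication.\<close>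

definition R_fun :: "real \<Rightarrow> 'a::real_inner \<Rightarrow> 'a \<Rightarrow> real" where
  "R_fun p a b = norm b powr p + (p - 1) * norm a powr p - p * (pow_vec p a \<bullet> b)"

text \<open>The integral over \<open>\<Omega>\<close> of \<open>(- div F - V) \<phi>\<close>. If \<open>F\<close> is not \<open>C\<^sup>1\<close> on \<open>\<Omega>\<close>, then \<open>div F\<close> is the
  distributional divergence, that is, the integral of \<open>- (div F) \<phi>\<close> is read as that of
  \<open>F \<bullet> grad \<phi>\<close>.\<close>

definition div_potential_integral ::
  "'a::euclidean_space set \<Rightarrow> ('a \<Rightarrow> 'a) \<Rightarrow> ('a \<Rightarrow> real) \<Rightarrow> ('a \<Rightarrow> real) \<Rightarrow> real" where
  "div_potential_integral \<Omega> F V \<phi> =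
     (if C1_on \<Omega> F
      then (LINT x:\<Omega>|lborel. (- divergence F x - V x) * \<phi> x)
      else (LINT x:\<Omega>|lborel. F x \<bullet> grad \<phi> x) - (LINT x:\<Omega>|lborel. V x * \<phi> x))"

end

theory Submission
  imports Defs
begin

text \<open>
  Write \<open>F = A |X|^(p-2) X\<close> and \<open>\<phi> = |u|^p\<close>. Because \<open>p > 1\<close>, the function \<open>|t|^p\<close> is \<open>C\<^sup>1\<close> with
  derivative \<open>p |t|^(p-2) t\<close>, so \<open>\<phi>\<close> is again \<open>C\<^sup>1\<close> with compact support and
  \<open>grad \<phi> = p |u|^(p-2) u grad u\<close> (\<open>C1_on_abs_powr\<close>, \<open>grad_abs_powr\<close>). Expanding the definition
  of \<open>R\<^sub>p\<close> and using homogeneity of \<open>|v|^(p-2) v\<close>, both remainders become, at every point,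
  \<open>A |w|^p + (p-1) A |X|^p \<phi> - F \<bullet> grad \<phi>\<close>, where \<open>w\<close> is \<open>grad u\<close> in the first identity and
  \<open>X/|X| \<bullet> grad u\<close> in the second (\<open>R_fun_scaleR_gradient\<close>, \<open>R_fun_directional\<close>). Integrating this
  identity proves the theorem as soon as each of the three terms is integrable and
  \<open>\<integral> - (div F) \<phi> = \<integral> F \<bullet> grad \<phi>\<close>.

  In the distributional case the last equation is the meaning of its left-hand side. If \<open>F\<close> is
  \<open>C\<^sup>1\<close>, it is the divergence theorem for the compactly supported field \<open>\<phi> F\<close>
  (\<open>integral_divergence_by_parts\<close>), which rests on the fact that a directional derivative of a
  compactly supported function integrates to zero. That fact needs no Fubini argument: the
  difference quotients integrate to zero by translation invariance of Lebesgue measure, and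
  dominated convergence passes to the limit.

  Integrability is clear for terms that are continuous on \<open>\<Omega>\<close> and vanish off a compact subset.
  Only \<open>A |X/|X| \<bullet> grad u|^p\<close> can be discontinuous, at the zeros of \<open>X\<close>. It is continuous on
  the open set where \<open>X\<close> is nonzero, it is \<open>0\<close> elsewhere, and it is dominated by
  \<open>|A| |grad u|^p\<close>.
\<close>

section \<open>Directional derivatives of compactly supported functions\<close>

text \<open>The bound on the directional derivative makes the difference quotients uniformly bounded by
  the mean value theorem; for steps of length at most \<open>norm b\<close> they all live in one fixed ball.\<close>

lemma has_bochner_integral_directional_derivative:
  fixes g :: "'a::euclidean_space \<Rightarrow> real"
  assumes der: "\<And>x. (g has_derivative g' x) (at x)"
    and bound: "\<And>x. \<bar>g' x b\<bar> \<le> M"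
    and K: "bounded K" "\<And>x. x \<notin> K \<Longrightarrow> g x = 0"
  shows "has_bochner_integral lborel (\<lambda>x. g' x b) 0"
proof -
  define t :: "nat \<Rightarrow> real" where "t n = inverse (real (Suc n))" for n
  define q where "q n x = (g (x + t n *\<^sub>R b) - g x) / t n" for n x
  have t: "0 < t n" "t n \<le> 1" for n
    by (auto simp: t_def field_simps)
  have cont: "continuous_on UNIV g"
    using der by (meson continuous_at_imp_continuous_on has_derivative_continuous)
  then have meas [measurable]: "g \<in> borel_measurable borel"
    by (rule borel_measurable_continuous_onI)
  obtain R where R: "\<And>x. x \<in> K \<Longrightarrow> norm x \<le> R"
    using K(1) by (auto simp: bounded_iff)
  have supp: "q n x = 0" if "x \<notin> cball 0 (R + norm b)" for n x
  proof -
    have "norm x \<le> norm (x + t n *\<^sub>R b) + t n * norm b"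
      using norm_triangle_ineq4[of "x + t n *\<^sub>R b" "t n *\<^sub>R b"] t[of n] by simp
    moreover have "t n * norm b \<le> norm b"
      using t[of n] by (simp add: mult_left_le_one_le)
    ultimately have "x \<notin> K" "x + t n *\<^sub>R b \<notin> K"
      using that R[of x] R[of "x + t n *\<^sub>R b"] norm_ge_zero[of b] by fastforce+
    then show ?thesis by (simp add: q_def K(2))
  qed
  have line: "((\<lambda>s. g (x + s *\<^sub>R b)) has_real_derivative g' (x + s *\<^sub>R b) b) (at s)" for x s
  proof -
    have "((\<lambda>s. g (x + s *\<^sub>R b)) has_derivative (\<lambda>h. g' (x + s *\<^sub>R b) (h *\<^sub>R b))) (at s)"
      by (rule has_derivative_compose[OF _ der]) (auto intro!: derivative_eq_intros)
    moreover have "g' (x + s *\<^sub>R b) (h *\<^sub>R b) = g' (x + s *\<^sub>R b) b * h" for h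
      using linear_cmul[OF has_derivative_linear[OF der]] by (simp add: mult.commute)
    ultimately show ?thesis
      by (simp add: has_field_derivative_def)
  qed
  have qbound: "\<bar>q n x\<bar> \<le> M" for n x
  proof -
    obtain z where z: "g (x + t n *\<^sub>R b) - g (x + 0 *\<^sub>R b) = (t n - 0) * g' (x + z *\<^sub>R b) b"
      using MVT2[OF t(1)[of n], of "\<lambda>s. g (x + s *\<^sub>R b)", OF line] by blast
    then have "q n x = g' (x + z *\<^sub>R b) b"
      using t(1)[of n] by (simp add: q_def)
    then show ?thesis using bound by simp
  qed
  have lim: "(\<lambda>n. q n x) \<longlonglongrightarrow> g' x b" for x
  proof -
    have "((\<lambda>s. (g (x + s *\<^sub>R b) - g x) / s) \<longlongrightarrow> g' x b) (at 0)"
      using line[of x 0] by (simp add: DERIV_def)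
    moreover have "filterlim t (at 0) sequentially"
      using LIMSEQ_inverse_real_of_nat t(1) unfolding filterlim_at t_def
      by (auto simp: eventually_sequentially less_imp_neq[symmetric])
    ultimately show ?thesis
      unfolding q_def by (rule filterlim_compose)
  qed
  have q_meas [measurable]: "q n \<in> borel_measurable lborel" for n
    unfolding q_def by measurable
  have lim_meas: "(\<lambda>x. g' x b) \<in> borel_measurable lborel"
    using lim q_meas by (rule borel_measurable_LIMSEQ_real)
  have g_int: "integrable lborel g"
  proof -
    have "compact (closure K)"
      using K(1) by simp
    then have "set_integrable lborel (closure K) g"
      using cont continuous_on_subset borel_integrable_compact
      unfolding set_integrable_def by (metis subset_UNIV)
    moreover have "(\<lambda>x. indicator (closure K) x *\<^sub>R g x) = g"
      using K(2) closure_subset[of K] by (fastforce simp: indicator_def)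
    ultimately show ?thesis
      by (simp only: set_integrable_def)
  qed
  have zero: "integral\<^sup>L lborel (q n) = 0" for n
  proof -
    have "integral\<^sup>L lborel g = integral\<^sup>L (distr lborel borel ((+) (t n *\<^sub>R b))) g"
      by (subst lborel_distr_plus) simp
    also have "\<dots> = (\<integral>x. g (t n *\<^sub>R b + x) \<partial>lborel)"
      by (rule integral_distr) auto
    finally have eq: "(\<integral>x. g (x + t n *\<^sub>R b) \<partial>lborel) = integral\<^sup>L lborel g"
      by (simp add: add.commute)
    have "integrable (distr lborel borel ((+) (t n *\<^sub>R b))) g"
      by (subst lborel_distr_plus) (rule g_int)
    then have "integrable lborel (\<lambda>x. g (x + t n *\<^sub>R b))"
      by (subst (asm) integrable_distr_eq) (auto simp: add.commute)
    then show ?thesis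
      unfolding q_def using g_int eq by simp
  qed
  define w where "w x = M * indicator (cball (0::'a) (R + norm b)) x" for x
  have w_int: "integrable lborel w"
    unfolding w_def by (intro integrable_mult_right integrable_real_indicator)
      (simp_all add: emeasure_lborel_cball_finite[simplified])
  have w_bound: "AE x in lborel. norm (q n x) \<le> w x" for n
    using qbound supp by (auto simp: w_def indicator_def intro!: AE_I2)
  have lim_AE: "AE x in lborel. (\<lambda>n. q n x) \<longlonglongrightarrow> g' x b"
    using lim by simp
  have "integrable lborel (\<lambda>x. g' x b)"
    by (rule integrable_dominated_convergence[OF lim_meas q_meas w_int lim_AE w_bound])
  moreover have "(\<lambda>n. integral\<^sup>L lborel (q n)) \<longlonglongrightarrow> (\<integral>x. g' x b \<partial>lborel)"
    by (rule integral_dominated_convergence[OF lim_meas q_meas w_int lim_AE w_bound])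
  then have "(\<integral>x. g' x b \<partial>lborel) = 0"
    unfolding zero by (simp add: LIMSEQ_const_iff)
  ultimately show ?thesis
    by (simp add: has_bochner_integral_iff)
qed

section \<open>Gradients, divergences and integration by parts\<close>

lemma C1_on_imp_continuous_on: "C1_on \<Omega> f \<Longrightarrow> continuous_on \<Omega> f"
  unfolding C1_on_def
  by (meson continuous_at_imp_continuous_on has_derivative_continuous)

lemma grad_eq:
  assumes "(f has_derivative f') (at x)"
  shows "grad f x = (\<Sum>b\<in>Basis. f' b *\<^sub>R b)"
  unfolding grad_def frechet_derivative_at[OF assms, symmetric] ..

lemma divergence_eq:
  assumes "(F has_derivative F') (at x)"
  shows "divergence F x = (\<Sum>b\<in>Basis. F' b \<bullet> b)"
  unfolding divergence_def frechet_derivative_at[OF assms, symmetric] ..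

lemma continuous_on_grad:
  assumes "C1_on \<Omega> f"
  shows "continuous_on \<Omega> (grad f)"
proof -
  obtain f' where f': "\<And>x. x \<in> \<Omega> \<Longrightarrow> (f has_derivative blinfun_apply (f' x)) (at x)"
    "continuous_on \<Omega> f'"
    using assms unfolding C1_on_def by blast
  have "continuous_on \<Omega> (\<lambda>x. \<Sum>b\<in>Basis. f' x b *\<^sub>R b)"
    by (intro continuous_intros f'(2))
  then show ?thesis
    by (rule continuous_on_eq) (simp add: grad_eq[OF f'(1)])
qed

lemma continuous_on_divergence:
  assumes "C1_on \<Omega> F"
  shows "continuous_on \<Omega> (divergence F)"
proof -
  obtain F' where F': "\<And>x. x \<in> \<Omega> \<Longrightarrow> (F has_derivative blinfun_apply (F' x)) (at x)"
    "continuous_on \<Omega> F'"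
    using assms unfolding C1_on_def by blast
  have "continuous_on \<Omega> (\<lambda>x. \<Sum>b\<in>Basis. F' x b \<bullet> b)"
    by (intro continuous_intros F'(2))
  then show ?thesis
    by (rule continuous_on_eq) (simp add: divergence_eq[OF F'(1)])
qed

lemma has_derivative_zero_outside_support:
  fixes f :: "'a::euclidean_space \<Rightarrow> 'b::real_normed_vector"
  assumes "open \<Omega>" "closed K" "\<And>x. x \<in> \<Omega> - K \<Longrightarrow> f x = 0" "x \<in> \<Omega> - K"
  shows "(f has_derivative (\<lambda>_. 0)) (at x)"
proof (rule has_derivative_transform_within_open)
  show "((\<lambda>_. 0) has_derivative (\<lambda>_. 0)) (at x)" by simp
  show "open (\<Omega> - K)" using assms by (simp add: open_Diff)
qed (use assms in auto)

lemma grad_zero_outside_support: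
  fixes f :: "'a::euclidean_space \<Rightarrow> real"
  assumes "open \<Omega>" "closed K" "\<And>x. x \<in> \<Omega> - K \<Longrightarrow> f x = 0" "x \<in> \<Omega> - K"
  shows "grad f x = 0"
  using grad_eq[OF has_derivative_zero_outside_support[OF assms]] by simp

lemma set_integrable_continuous_compact_support:
  fixes f :: "'a::euclidean_space \<Rightarrow> real"
  assumes "continuous_on \<Omega> f" "compact K" "K \<subseteq> \<Omega>" "\<And>x. x \<in> \<Omega> - K \<Longrightarrow> f x = 0"
  shows "set_integrable lborel \<Omega> f"
proof -
  have "integrable lborel (\<lambda>x. indicator K x *\<^sub>R f x)"
    using assms borel_integrable_compact continuous_on_subset by blast
  moreover have "(\<lambda>x. indicator K x *\<^sub>R f x) = (\<lambda>x. indicator \<Omega> x *\<^sub>R f x)"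
    using assms(3,4) by (fastforce simp: indicator_def)
  ultimately show ?thesis
    by (simp only: set_integrable_def)
qed

text \<open>The divergence theorem for \<open>\<phi> F\<close>. Extending a component by zero off \<open>\<Omega>\<close> gives a function that
  is differentiable everywhere, because \<open>\<Omega>\<close> and the complement of \<open>K\<close> form an open cover.\<close>

lemma integral_divergence_by_parts:
  fixes F :: "'a::euclidean_space \<Rightarrow> 'a" and \<phi> :: "'a \<Rightarrow> real"
  assumes "open \<Omega>" and F: "C1_on \<Omega> F" and \<phi>: "C1_on \<Omega> \<phi>"
    and K: "compact K" "K \<subseteq> \<Omega>" "\<And>x. x \<in> \<Omega> - K \<Longrightarrow> \<phi> x = 0"
  shows "(LINT x:\<Omega>|lborel. - divergence F x * \<phi> x) = (LINT x:\<Omega>|lborel. F x \<bullet> grad \<phi> x)"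
proof -
  obtain F' where F': "\<And>x. x \<in> \<Omega> \<Longrightarrow> (F has_derivative blinfun_apply (F' x)) (at x)"
    "continuous_on \<Omega> F'"
    using F unfolding C1_on_def by blast
  obtain \<phi>' where \<phi>': "\<And>x. x \<in> \<Omega> \<Longrightarrow> (\<phi> has_derivative blinfun_apply (\<phi>' x)) (at x)"
    "continuous_on \<Omega> \<phi>'"
    using \<phi> unfolding C1_on_def by blast
  note cont = C1_on_imp_continuous_on[OF F] C1_on_imp_continuous_on[OF \<phi>]
    continuous_on_divergence[OF F] continuous_on_grad[OF \<phi>]
  have clK: "closed K" using K(1) by (rule compact_imp_closed)
  have \<phi>'0: "\<phi>' x h = 0" if "x \<in> \<Omega> - K" for x h
    using has_derivative_unique[OF \<phi>'(1) has_derivative_zero_outside_support[OF assms(1) clK K(3)]]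
      that by (metis DiffD1)
  define D where "D b x h = \<phi> x * (F' x h \<bullet> b) + \<phi>' x h * (F x \<bullet> b)" for b x h
  have D0: "D b x h = 0" if "x \<in> \<Omega> - K" for b x h
    using that K(3) \<phi>'0 by (simp add: D_def)
  have D_int: "has_bochner_integral lborel (\<lambda>x. if x \<in> \<Omega> then D b x b else 0) 0" for b
  proof -
    define g where "g x = (if x \<in> \<Omega> then \<phi> x * (F x \<bullet> b) else 0)" for x
    define g' where "g' x = (if x \<in> \<Omega> then D b x else (\<lambda>_. 0))" for x
    have der: "(g has_derivative g' x) (at x)" for x
    proof (cases "x \<in> \<Omega>")
      case True
      have "((\<lambda>x. \<phi> x * (F x \<bullet> b)) has_derivative D b x) (at x)"
        unfolding D_def using F'(1)[OF True] \<phi>'(1)[OF True]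
        by (auto intro!: derivative_eq_intros)
      then have "(g has_derivative D b x) (at x)"
        using assms(1) True
        by (rule has_derivative_transform_within_open) (simp add: g_def)
      then show ?thesis using True by (simp add: g'_def)
    next
      case False
      then have "x \<in> UNIV - K" using K(2) by auto
      then have "(g has_derivative (\<lambda>_. 0)) (at x)"
        by (rule has_derivative_zero_outside_support[OF open_UNIV clK, rotated])
          (use K(3) in \<open>auto simp: g_def\<close>)
      then show ?thesis using False by (simp add: g'_def)
    qed
    have "continuous_on K (\<lambda>x. D b x b)"
      unfolding D_def
      by (intro continuous_intros cont[THEN continuous_on_subset]
          F'(2)[THEN continuous_on_subset] \<phi>'(2)[THEN continuous_on_subset] K(2))
    then have "bounded ((\<lambda>x. D b x b) ` K)"
      using K(1) compact_continuous_image compact_imp_bounded by blast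
    then obtain M where M: "0 < M" "\<And>x. x \<in> K \<Longrightarrow> \<bar>D b x b\<bar> \<le> M"
      by (auto simp: bounded_pos)
    have "\<bar>g' x b\<bar> \<le> M" for x
      using M D0[of x b b] by (cases "x \<in> K") (auto simp: g'_def)
    then have "has_bochner_integral lborel (\<lambda>x. g' x b) 0"
      using der compact_imp_bounded[OF K(1)] K(3)
      by (intro has_bochner_integral_directional_derivative[where g = g and K = K])
        (auto simp: g_def)
    moreover have "g' x b = (if x \<in> \<Omega> then D b x b else 0)" for x
      by (simp add: g'_def)
    ultimately show ?thesis by simp
  qed
  have pointwise: "(\<Sum>b\<in>Basis. if x \<in> \<Omega> then D b x b else 0)
      = indicator \<Omega> x *\<^sub>R (divergence F x * \<phi> x + F x \<bullet> grad \<phi> x)" for x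
    by (simp add: D_def divergence_eq[OF F'(1)] grad_eq[OF \<phi>'(1)] sum.distrib
        inner_sum_right sum_distrib_left mult.commute indicator_def)
  have "has_bochner_integral lborel (\<lambda>x. \<Sum>b\<in>Basis. if x \<in> \<Omega> then D b x b else 0)
      (\<Sum>b\<in>(Basis::'a set). 0)"
    by (rule has_bochner_integral_sum) (rule D_int)
  then have total: "(LINT x:\<Omega>|lborel. divergence F x * \<phi> x + F x \<bullet> grad \<phi> x) = 0"
    unfolding pointwise by (simp add: set_lebesgue_integral_def has_bochner_integral_iff)
  have int1: "set_integrable lborel \<Omega> (\<lambda>x. divergence F x * \<phi> x)"
    by (rule set_integrable_continuous_compact_support[OF _ K(1,2)])
      (auto intro!: continuous_intros cont simp: K(3))
  have "grad \<phi> x = 0" if "x \<in> \<Omega> - K" for x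
    using grad_zero_outside_support[OF assms(1) clK K(3) that] .
  then have int2: "set_integrable lborel \<Omega> (\<lambda>x. F x \<bullet> grad \<phi> x)"
    by (intro set_integrable_continuous_compact_support[OF _ K(1,2)])
      (auto intro!: continuous_intros cont)
  show ?thesis
    using total set_integral_add(2)[OF int1 int2]
    by (simp add: set_lebesgue_integral_def)
qed

section \<open>The power of the absolute value\<close>

lemma norm_pow_vec: "norm (pow_vec p v) = norm v powr (p - 1)"
  by (cases "v = 0") (simp_all add: pow_vec_def powr_diff power2_eq_square)

lemma pow_vec_scaleR: "pow_vec p (c *\<^sub>R v) = pow_vec p c *\<^sub>R pow_vec p v"
  by (simp add: pow_vec_def powr_mult)

text \<open>At the origin continuity comes from \<open>norm (pow_vec p v) = norm v powr (p - 1)\<close>, whose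
  exponent is positive even when \<open>p < 2\<close> and the factor \<open>norm v powr (p - 2)\<close> blows up.\<close>

lemma continuous_on_pow_vec [continuous_intros]:
  fixes f :: "'b::topological_space \<Rightarrow> 'a::real_inner"
  assumes "p > 1" "continuous_on S f"
  shows "continuous_on S (\<lambda>x. pow_vec p (f x))"
proof -
  have "isCont (pow_vec p) v" for v :: 'a
  proof (cases "v = 0")
    case True
    have "((\<lambda>v::'a. norm v powr (p - 1)) \<longlongrightarrow> 0) (at 0)"
      using assms(1) by (intro tendsto_zero_powrI[OF tendsto_norm_zero tendsto_const]) auto
    then have "((pow_vec p :: 'a \<Rightarrow> 'a) \<longlongrightarrow> 0) (at 0)"
      by (intro tendsto_norm_zero_cancel[of "pow_vec p"]) (simp add: norm_pow_vec)
    then show ?thesis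
      using True by (simp add: isCont_def pow_vec_def)
  next
    case False
    then show ?thesis
      unfolding pow_vec_def by (intro continuous_intros) auto
  qed
  then have "continuous_on UNIV (pow_vec p :: 'a \<Rightarrow> 'a)"
    by (simp add: continuous_at_imp_continuous_on)
  then show ?thesis
    using assms(2) by (rule continuous_on_compose2) simp
qed

lemma has_real_derivative_abs_powr:
  assumes "p > 1"
  shows "((\<lambda>t::real. \<bar>t\<bar> powr p) has_real_derivative p * pow_vec p t) (at t)"
proof (cases "t = 0")
  case True
  have "(pow_vec p \<longlongrightarrow> pow_vec p 0) (at (0::real))"
    using continuous_on_pow_vec[OF assms continuous_on_id, of "UNIV :: real set"]
    by (simp add: continuous_on_eq_continuous_at isCont_def)
  moreover have "\<forall>h::real. h \<noteq> 0 \<longrightarrow> \<bar>h\<bar> powr p / h = pow_vec p h"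
    by (simp add: pow_vec_def powr_diff power2_eq_square field_simps)
  then have "((\<lambda>h. \<bar>h\<bar> powr p / h) \<longlongrightarrow> pow_vec p 0) (at (0::real))
      \<longleftrightarrow> (pow_vec p \<longlongrightarrow> pow_vec p 0) (at (0::real))"
    by (rule LIM_equal)
  ultimately have "((\<lambda>h. \<bar>h\<bar> powr p / h) \<longlongrightarrow> pow_vec p 0) (at (0::real))"
    by simp
  then show ?thesis
    using True by (simp add: DERIV_def pow_vec_def)
next
  case False
  have "(abs has_real_derivative sgn t) (at t)"
    using GDERIV_norm[OF False] by (simp add: gderiv_def has_field_derivative_def mult_commute_abs)
  then have "((\<lambda>t. \<bar>t\<bar> powr p) has_real_derivative p * \<bar>t\<bar> powr (p - 1) * sgn t) (at t)"
    using False by (auto intro!: derivative_eq_intros)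
  moreover have "\<bar>t\<bar> powr (p - 1) * sgn t = pow_vec p t"
    using False by (auto simp: pow_vec_def powr_diff power2_eq_square sgn_if field_simps)
  ultimately show ?thesis
    by (simp add: mult.assoc)
qed

lemma has_derivative_abs_powr:
  fixes u :: "'a::real_normed_vector \<Rightarrow> real"
  assumes "p > 1" "(u has_derivative u') (at x)"
  shows "((\<lambda>x. \<bar>u x\<bar> powr p) has_derivative (\<lambda>h. p * pow_vec p (u x) * u' h)) (at x)"
  using has_derivative_compose[OF assms(2)
      has_real_derivative_abs_powr[OF assms(1), unfolded has_field_derivative_def]]
  by simp

lemma C1_on_abs_powr:
  fixes u :: "'a::euclidean_space \<Rightarrow> real"
  assumes "p > 1" "C1_on \<Omega> u"
  shows "C1_on \<Omega> (\<lambda>x. \<bar>u x\<bar> powr p)"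
proof -
  obtain u' where u': "\<And>x. x \<in> \<Omega> \<Longrightarrow> (u has_derivative blinfun_apply (u' x)) (at x)"
    "continuous_on \<Omega> u'"
    using assms(2) unfolding C1_on_def by blast
  have "continuous_on \<Omega> (\<lambda>x. (p * pow_vec p (u x)) *\<^sub>R u' x)"
    by (intro continuous_intros u'(2) assms C1_on_imp_continuous_on)
  moreover have "((\<lambda>x. \<bar>u x\<bar> powr p) has_derivative
      blinfun_apply ((p * pow_vec p (u x)) *\<^sub>R u' x)) (at x)" if "x \<in> \<Omega>" for x
    using has_derivative_abs_powr[OF assms(1) u'(1)[OF that]]
    by (simp add: scaleR_blinfun.rep_eq)
  ultimately show ?thesis
    unfolding C1_on_def
    by (intro exI[of _ "\<lambda>x. (p * pow_vec p (u x)) *\<^sub>R u' x"] conjI ballI)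
qed

lemma grad_abs_powr:
  assumes "p > 1" "C1_on \<Omega> u" "x \<in> \<Omega>"
  shows "grad (\<lambda>x. \<bar>u x\<bar> powr p) x = (p * pow_vec p (u x)) *\<^sub>R grad u x"
proof -
  obtain u' where u': "(u has_derivative u') (at x)"
    using assms(2,3) unfolding C1_on_def by blast
  show ?thesis
    unfolding grad_eq[OF u'] grad_eq[OF has_derivative_abs_powr[OF assms(1) u']]
    by (simp add: scaleR_sum_right)
qed

section \<open>The remainders\<close>

lemma R_fun_scaleR_gradient:
  "R_fun p (c *\<^sub>R v) w
     = norm w powr p + (p - 1) * norm v powr p * \<bar>c\<bar> powr p - pow_vec p v \<bullet> ((p * pow_vec p c) *\<^sub>R w)"
  by (simp add: R_fun_def pow_vec_scaleR powr_mult)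

text \<open>Passing to scalar arguments keeps the mixed term, since \<open>pow_vec p (norm v)\<close> times the unit
  vector of \<open>v\<close> is \<open>pow_vec p v\<close>; at \<open>v = 0\<close> both conventions give \<open>0\<close>.\<close>

lemma R_fun_directional:
  "R_fun p (c * norm v) ((v /\<^sub>R norm v) \<bullet> w)
     = \<bar>(v /\<^sub>R norm v) \<bullet> w\<bar> powr p + (p - 1) * norm v powr p * \<bar>c\<bar> powr p
         - pow_vec p v \<bullet> ((p * pow_vec p c) *\<^sub>R w)"
proof -
  have "pow_vec p (norm v) *\<^sub>R (v /\<^sub>R norm v) = pow_vec p v"
    by (cases "v = 0") (simp_all add: pow_vec_def)
  then have "pow_vec p (norm v) * ((v /\<^sub>R norm v) \<bullet> w) = pow_vec p v \<bullet> w"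
    by (metis inner_scaleR_left)
  then have "pow_vec p (c * norm v) * ((v /\<^sub>R norm v) \<bullet> w) = pow_vec p c * (pow_vec p v \<bullet> w)"
    using pow_vec_scaleR[of p c "norm v"] by (simp add: mult.assoc)
  then show ?thesis
    unfolding R_fun_def by (simp add: powr_mult abs_mult mult_ac)
qed

section \<open>The two identities\<close>

theorem theorem1p3:
  fixes \<Omega> :: "(real ^ 'n) set"
    and p :: real
    and A :: "real ^ 'n \<Rightarrow> real"
    and X :: "real ^ 'n \<Rightarrow> real ^ 'n"
    and u :: "real ^ 'n \<Rightarrow> real"
  assumes "open \<Omega>"
    and "p > 1"
    and "C1_on \<Omega> A"
    and "C1_on \<Omega> X"
    and "C1_compact_support \<Omega> u"
  shows "(LINT x:\<Omega>|lborel. A x * norm (grad u x) powr p)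
           - div_potential_integral \<Omega> (\<lambda>x. A x *\<^sub>R pow_vec p (X x))
               (\<lambda>x. (p - 1) * A x * norm (X x) powr p) (\<lambda>x. \<bar>u x\<bar> powr p)
         = (LINT x:\<Omega>|lborel. A x * R_fun p (u x *\<^sub>R X x) (grad u x))
       \<and> (LINT x:\<Omega>|lborel. A x * \<bar>(X x /\<^sub>R norm (X x)) \<bullet> grad u x\<bar> powr p)
           - div_potential_integral \<Omega> (\<lambda>x. A x *\<^sub>R pow_vec p (X x))
               (\<lambda>x. (p - 1) * A x * norm (X x) powr p) (\<lambda>x. \<bar>u x\<bar> powr p)
         = (LINT x:\<Omega>|lborel. A x * R_fun p (u x * norm (X x)) ((X x /\<^sub>R norm (X x)) \<bullet> grad u x))"
proof -
  define K where "K = closure {x\<in>\<Omega>. u x \<noteq> 0}"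
  define F where "F x = A x *\<^sub>R pow_vec p (X x)" for x
  define V where "V x = (p - 1) * A x * norm (X x) powr p" for x
  define \<phi> where "\<phi> x = \<bar>u x\<bar> powr p" for x
  define d where "d x = (X x /\<^sub>R norm (X x)) \<bullet> grad u x" for x
  have u: "C1_on \<Omega> u" and K: "compact K" "K \<subseteq> \<Omega>"
    using assms(5) by (auto simp: C1_compact_support_def K_def)
  have clK: "closed K" by (simp add: K_def)
  have u0: "u x = 0" if "x \<in> \<Omega> - K" for x
    using that closure_subset[of "{x\<in>\<Omega>. u x \<noteq> 0}"] by (auto simp: K_def)
  have \<phi>0: "\<phi> x = 0" if "x \<in> \<Omega> - K" for x
    using u0[OF that] by (simp add: \<phi>_def)
  have \<phi>: "C1_on \<Omega> \<phi>"
    unfolding \<phi>_def by (rule C1_on_abs_powr[OF assms(2) u])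
  have grad_u0: "grad u x = 0" if "x \<in> \<Omega> - K" for x
    using grad_zero_outside_support[OF assms(1) clK u0 that] .
  have grad_\<phi>: "grad \<phi> x = (p * pow_vec p (u x)) *\<^sub>R grad u x" if "x \<in> \<Omega>" for x
    unfolding \<phi>_def by (rule grad_abs_powr[OF assms(2) u that])
  note cont = assms(3,4)[THEN C1_on_imp_continuous_on] C1_on_imp_continuous_on[OF \<phi>]
    continuous_on_grad[OF u] continuous_on_grad[OF \<phi>]
  have contF: "continuous_on \<Omega> F"
    unfolding F_def by (intro continuous_intros cont assms(2))
  have contV: "continuous_on \<Omega> V"
    unfolding V_def using assms(2) by (auto intro!: continuous_intros continuous_on_powr' cont)

  have intV: "set_integrable lborel \<Omega> (\<lambda>x. V x * \<phi> x)"
    by (rule set_integrable_continuous_compact_support[OF _ K])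
      (auto intro!: continuous_intros cont contV simp: \<phi>0)
  have "grad \<phi> x = 0" if "x \<in> \<Omega> - K" for x
    using grad_zero_outside_support[OF assms(1) clK \<phi>0 that] .
  then have intF: "set_integrable lborel \<Omega> (\<lambda>x. F x \<bullet> grad \<phi> x)"
    by (intro set_integrable_continuous_compact_support[OF _ K])
      (auto intro!: continuous_intros cont contF)
  have intG: "set_integrable lborel \<Omega> (\<lambda>x. A x * norm (grad u x) powr p)"
    using assms(2)
    by (intro set_integrable_continuous_compact_support[OF _ K])
      (auto intro!: continuous_intros continuous_on_powr' cont simp: grad_u0)
  have intd: "set_integrable lborel \<Omega> (\<lambda>x. A x * \<bar>d x\<bar> powr p)"
  proof -
    let ?U = "{x\<in>\<Omega>. X x \<noteq> 0}"
    have "open ?U"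
      using continuous_open_preimage[OF cont(2) assms(1), of "- {0}"]
      by (simp add: vimage_def Int_def open_Compl)
    moreover have "continuous_on ?U (\<lambda>x. A x * \<bar>d x\<bar> powr p)"
      unfolding d_def using assms(2)
      by (auto intro!: continuous_intros continuous_on_powr' cont[THEN continuous_on_subset])
    ultimately have "(\<lambda>x. indicator ?U x *\<^sub>R (A x * \<bar>d x\<bar> powr p)) \<in> borel_measurable borel"
      by (intro borel_measurable_continuous_on_indicator) auto
    moreover have "(\<lambda>x. indicator ?U x *\<^sub>R (A x * \<bar>d x\<bar> powr p))
        = (\<lambda>x. indicator \<Omega> x *\<^sub>R (A x * \<bar>d x\<bar> powr p))"
      by (auto simp: indicator_def d_def)
    ultimately have meas: "(\<lambda>x. indicator \<Omega> x *\<^sub>R (A x * \<bar>d x\<bar> powr p)) \<in> borel_measurable lborel"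
      by (simp only: measurable_lborel1 measurable_lborel2)
    have "\<bar>d x\<bar> \<le> norm (grad u x)" for x
    proof -
      have "\<bar>d x\<bar> \<le> norm (X x /\<^sub>R norm (X x)) * norm (grad u x)"
        unfolding d_def by (rule Cauchy_Schwarz_ineq2)
      also have "\<dots> \<le> 1 * norm (grad u x)"
        by (intro mult_right_mono) (simp_all add: inverse_eq_divide)
      finally show ?thesis by simp
    qed
    then have "\<bar>A x * \<bar>d x\<bar> powr p\<bar> \<le> \<bar>A x * norm (grad u x) powr p\<bar>" for x
      using assms(2) by (auto simp: abs_mult intro!: mult_left_mono powr_mono2)
    then show ?thesis
      using intG meas unfolding set_integrable_def
      by (elim Bochner_Integration.integrable_bound) (auto simp: indicator_def)
  qed

  have potential: "div_potential_integral \<Omega> F V \<phi>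
      = (LINT x:\<Omega>|lborel. F x \<bullet> grad \<phi> x) - (LINT x:\<Omega>|lborel. V x * \<phi> x)"
  proof (cases "C1_on \<Omega> F")
    case True
    have "set_integrable lborel \<Omega> (\<lambda>x. - divergence F x * \<phi> x)"
      by (rule set_integrable_continuous_compact_support[OF _ K])
        (auto intro!: continuous_intros cont continuous_on_divergence True simp: \<phi>0)
    then have "(LINT x:\<Omega>|lborel. (- divergence F x - V x) * \<phi> x)
        = (LINT x:\<Omega>|lborel. - divergence F x * \<phi> x) - (LINT x:\<Omega>|lborel. V x * \<phi> x)"
      using set_integral_diff(2)[OF _ intV] by (simp add: left_diff_distrib)
    then show ?thesis
      using integral_divergence_by_parts[OF assms(1) True \<phi> K \<phi>0] True
      by (simp add: div_potential_integral_def)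
  next
    case False
    then show ?thesis by (simp add: div_potential_integral_def)
  qed

  \<comment> \<open>Both identities are this linear combination of integrals, with \<open>G\<close> the first integrand on the
    left and \<open>R\<close> the integrand on the right.\<close>
  have combine: "(LINT x:\<Omega>|lborel. G x) - div_potential_integral \<Omega> F V \<phi> = (LINT x:\<Omega>|lborel. R x)"
    if G: "set_integrable lborel \<Omega> G"
      and R: "\<And>x. x \<in> \<Omega> \<Longrightarrow> R x = G x + V x * \<phi> x - F x \<bullet> grad \<phi> x" for G R
  proof -
    have "(LINT x:\<Omega>|lborel. R x) = (LINT x:\<Omega>|lborel. G x + V x * \<phi> x - F x \<bullet> grad \<phi> x)"
      using assms(1) R by (intro set_lebesgue_integral_cong) auto
    then show ?thesis
      using G intV intF potential by (simp add: set_integral_add set_integral_diff)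
  qed
  have "A x * R_fun p (u x *\<^sub>R X x) (grad u x)
      = A x * norm (grad u x) powr p + V x * \<phi> x - F x \<bullet> grad \<phi> x" if "x \<in> \<Omega>" for x
    unfolding R_fun_scaleR_gradient grad_\<phi>[OF that] V_def F_def \<phi>_def
    by (simp add: algebra_simps)
  note first = combine[OF intG this]
  have "A x * R_fun p (u x * norm (X x)) (d x)
      = A x * \<bar>d x\<bar> powr p + V x * \<phi> x - F x \<bullet> grad \<phi> x" if "x \<in> \<Omega>" for x
    unfolding d_def R_fun_directional grad_\<phi>[OF that] V_def F_def \<phi>_def
    by (simp add: algebra_simps)
  note second = combine[OF intd this]
  show ?thesis
    using first second unfolding F_def V_def \<phi>_def d_def by blast
qed

end
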